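(* Assume an ideal log. A monitor with internal placement is complete for the Causal Observability Problem ($\mathbf{COP}$), and a monitor with external placement is sound for $\mathbf{COP}$. Neither achieves the other property: a monitor with internal placement is not sound, and a monitor with external placement is not complete.
   Context: **Executions.** There are $N\ge 2$ asynchronous processes $p_1,\dots,p_N$ communicating through atomic shared memory. Every event occurs at a single point of real time, no two events are simultaneous, and $e\prec f$ means that event $e$ occurs before event $f$ in real time. An operation $\mathit{op}$ executed by a process has an invocation event $\mathrm{inv}(\mathit{op})$ and a later response event $\mathrm{res}(\mathit{op})$, called its true boundaries. The true boundaries are transfers of control between a process and its caller; they are not shared-memory steps. The real-time order is $\mathit{op}_A <_H \mathit{op}_B \iff \mathrm{res}(\mathit{op}_A)\prec \mathrm{inv}(\mathit{op}_B)$. Two operations are concurrent, $\mathit{op}_A\parallel \mathit{op}_B$, if neither precedes the other in $<_H$. **Monitors.** A monitor is a protocol that, for each operation $\mathit{op}$, makes the process executing $\mathit{op}$ invoke shared-memory objects (of any type) around the true boundaries of $\mathit{op}$. These invocations are called interface events. By convention a monitor is modelled as emitting exactly one interface event per boundary: $\widehat{\mathrm{inv}}(\mathit{op})$, associated with $\mathrm{inv}(\mathit{op})$, and $\widehat{\mathrm{res}}(\mathit{op})$, associated with $\mathrm{res}(\mathit{op})$. For each operation, the monitor prescribes the program order of the four events $\mathrm{inv}(\mathit{op}),\mathrm{res}(\mathit{op}),\widehat{\mathrm{inv}}(\mathit{op}),\widehat{\mathrm{res}}(\mathit{op})$ at the executing process. The monitor answers $\mathrm{Precedes}(A,B)=\mathtt{true}$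 iff $\widehat{\mathrm{res}}(\mathit{op}_A)\prec^{L}\widehat{\mathrm{inv}}(\mathit{op}_B)$, where $\prec^L$ is the happened-before order that the monitor has on interface events. **Ideal log.** The monitor operates under an ideal log if every interface event $e$ has a linearization point $\mathrm{lp}(e)$ (the instant at which it takes effect), and $e_1\prec^L e_2 \iff \mathrm{lp}(e_1)\prec \mathrm{lp}(e_2)$. Linearization points are distinct from the instants of all true boundaries. **Placement.** A monitor has internal placement if, for every operation, $\mathrm{inv}(\mathit{op})\prec \mathrm{lp}(\widehat{\mathrm{inv}}(\mathit{op}))$ and $\mathrm{lp}(\widehat{\mathrm{res}}(\mathit{op}))\prec \mathrm{res}(\mathit{op})$. It has external placement if, for every operation, $\mathrm{lp}(\widehat{\mathrm{inv}}(\mathit{op}))\prec \mathrm{inv}(\mathit{op})$ and $\mathrm{res}(\mathit{op})\prec \mathrm{lp}(\widehat{\mathrm{res}}(\mathit{op}))$. **Asynchrony.** There is no bound on relative process speeds, and processes share no synchronization restricting how their steps interleave: given operations on distinct processes, every interleaving of the per-process event sequences (true boundaries and linearization points of interface events) that respects each process's program order is an admissible execution. **$\mathbf{COP}$ properties of a monitor.** Complete: in every execution, for all $\mathit{op}_A,\mathit{op}_B$, $\mathit{op}_A<_H\mathit{op}_B \Rightarrow \mathrm{Precedes}(A,B)=\mathtt{true}$. Sound: in every execution, for all $\mathit{op}_A,\mathit{op}_B$, $\mathrm{Precedes}(A,B)=\mathtt{true}\Rightarrow \mathit{op}_A<_H\mathit{op}_B$. *)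

theory Defs
  imports Complex_Main "HOL-Library.Sublist"
begin

datatype boundary = Inv | Res

datatype 'op event =
    True_Boundary "'op \<times> boundary"
  | Interface "'op \<times> boundary"

definition events_of :: "'op \<Rightarrow> 'op event set" where
  "events_of A =
     {True_Boundary (A, Inv), True_Boundary (A, Res), Interface (A, Inv), Interface (A, Res)}"

text \<open>
  Real time is the real line. \<open>lp\<close> is the instant at which an interface event takes effect; it is
  unrelated to the happened-before order \<open>hb\<close> on interface events unless the log is ideal.
  The values of these functions at operations outside \<open>ops\<close> carry no meaning.
\<close>

record 'op execution =
  ops :: "'op set"
  time :: "'op \<times> boundary \<Rightarrow> real"
  lp :: "'op \<times> boundary \<Rightarrow> real"
  hb :: "'op \<times> boundary \<Rightarrow> 'op \<times> boundary \<Rightarrow> bool"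

fun instant :: "'op execution \<Rightarrow> 'op event \<Rightarrow> real" where
  "instant X (True_Boundary b) = time X b"
| "instant X (Interface e) = lp X e"

definition occurs_in_order :: "'op execution \<Rightarrow> 'op event list \<Rightarrow> bool" where
  "occurs_in_order X w \<longleftrightarrow> sorted_wrt (\<lambda>e f. instant X e < instant X f) w"

text \<open>
  A program order of an operation lists its four events. Nothing is prescribed about the position
  of the interface events relative to the true boundaries or to each other.
\<close>

definition is_program_order :: "'op \<Rightarrow> 'op event list \<Rightarrow> bool" where
  "is_program_order A w \<longleftrightarrow>
     distinct w \<and> set w = events_of A \<and>
     subseq [True_Boundary (A, Inv), True_Boundary (A, Res)] w"

definition interleaving :: "('op \<Rightarrow> 'op event list) \<Rightarrow> 'op set \<Rightarrow> 'op event list \<Rightarrow> bool" where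
  "interleaving po S w \<longleftrightarrow>
     distinct w \<and> set w = (\<Union>A\<in>S. events_of A) \<and> (\<forall>A\<in>S. subseq (po A) w)"

definition well_formed :: "('op \<Rightarrow> 'op event list) \<Rightarrow> 'op execution \<Rightarrow> bool" where
  "well_formed po X \<longleftrightarrow>
     inj_on (time X) (ops X \<times> UNIV) \<and> (\<forall>A\<in>ops X. occurs_in_order X (po A))"

text \<open>
  The processes are \<open>1, \<dots>, N\<close>, and \<open>proc A\<close> is the process executing the operation \<open>A\<close>. The monitor
  is given by the program orders \<open>po\<close> that it prescribes, and \<open>execs\<close> is the set of admissible
  executions of the processes under this monitor.
\<close>

locale monitored_system =
  fixes N :: nat
    and proc :: "'op \<Rightarrow> nat"
    and po :: "'op \<Rightarrow> 'op event list"
    and execs :: "'op execution set"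
  assumes two_processes: "N \<ge> 2"
    and processes: "range proc = {1..N}"
    and program_order: "is_program_order A (po A)"
    and well_formed: "X \<in> execs \<Longrightarrow> well_formed po X"
    and asynchrony: "\<lbrakk>inj_on proc S; interleaving po S w\<rbrakk>
          \<Longrightarrow> \<exists>X\<in>execs. ops X = S \<and> occurs_in_order X w"

definition ideal_log :: "'op execution set \<Rightarrow> bool" where
  "ideal_log execs \<longleftrightarrow> (\<forall>X\<in>execs. \<forall>e\<in>ops X \<times> UNIV.
     (\<forall>f\<in>ops X \<times> UNIV. hb X e f \<longleftrightarrow> lp X e < lp X f) \<and>
     (\<forall>b\<in>ops X \<times> UNIV. lp X e \<noteq> time X b))"

definition internal_placement :: "'op execution set \<Rightarrow> bool" where
  "internal_placement execs \<longleftrightarrow> (\<forall>X\<in>execs. \<forall>A\<in>ops X.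
     time X (A, Inv) < lp X (A, Inv) \<and> lp X (A, Res) < time X (A, Res))"

definition external_placement :: "'op execution set \<Rightarrow> bool" where
  "external_placement execs \<longleftrightarrow> (\<forall>X\<in>execs. \<forall>A\<in>ops X.
     lp X (A, Inv) < time X (A, Inv) \<and> time X (A, Res) < lp X (A, Res))"

definition real_time_before :: "'op execution \<Rightarrow> 'op \<Rightarrow> 'op \<Rightarrow> bool" where
  "real_time_before X A B \<longleftrightarrow> time X (A, Res) < time X (B, Inv)"

definition Precedes :: "'op execution \<Rightarrow> 'op \<Rightarrow> 'op \<Rightarrow> bool" where
  "Precedes X A B \<longleftrightarrow> hb X (A, Res) (B, Inv)"

definition COP_complete :: "'op execution set \<Rightarrow> bool" where
  "COP_complete execs \<longleftrightarrow>
     (\<forall>X\<in>execs. \<forall>A\<in>ops X. \<forall>B\<in>ops X. real_time_before X A B \<longrightarrow> Precedes X A B)"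

definition COP_sound :: "'op execution set \<Rightarrow> bool" where
  "COP_sound execs \<longleftrightarrow>
     (\<forall>X\<in>execs. \<forall>A\<in>ops X. \<forall>B\<in>ops X. Precedes X A B \<longrightarrow> real_time_before X A B)"

end

theory Submission
  imports Defs
begin

text \<open>
  The positive claims are the inequality chains
  \<open>lp (A, Res) < res A < inv B < lp (B, Inv)\<close> (internal placement) and
  \<open>res A < lp (A, Res) < lp (B, Inv) < inv B\<close> (external placement), whose middle inequality is the
  premise and whose outer ones are the placement.
  For the negative claims, run an operation \<open>B\<close> of another process entirely between the response
  of \<open>A\<close> and its associated interface event: the two events of \<open>A\<close> lie on opposite sides of all
  the events of \<open>B\<close>, so the monitor and real time disagree about whether \<open>A\<close> precedes \<open>B\<close>.
\<close>

lemma events_of_disjoint: "A \<noteq> B \<Longrightarrow> events_of A \<inter> events_of B = {}"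
  by (auto simp: events_of_def)

context monitored_system
begin

lemma distinct_program_order: "distinct (po A)"
  and set_program_order: "set (po A) = events_of A"
  using program_order[of A] by (auto simp: is_program_order_def)

lemma obtain_operations_on_distinct_processes:
  obtains A B where "proc A \<noteq> proc B"
proof -
  have "{1, 2} \<subseteq> range proc"
    using two_processes processes by auto
  then obtain A B where "1 = proc A" "2 = proc B"
    by blast
  then show thesis
    using that[of A B] by simp
qed

text \<open>With this, \<open>asynchrony\<close> yields an admissible execution in which
  \<open>A\<close> runs alone.\<close>

lemma interleaving_program_order: "interleaving po {A} (po A)"
  using distinct_program_order set_program_order by (simp add: interleaving_def)

text \<open>
  The uniform order of \<open>x\<close> and \<open>y\<close> over all executions is a property of the program order of \<open>A\<close>,
  as the execution in which \<open>A\<close> runs alone shows.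
\<close>

lemma split_program_order:
  assumes "x \<in> events_of A" "y \<in> events_of A"
    and before: "\<And>X. \<lbrakk>X \<in> execs; A \<in> ops X\<rbrakk> \<Longrightarrow> instant X x < instant X y"
  obtains us vs where "po A = us @ x # vs" "y \<in> set vs"
proof -
  obtain us vs where po: "po A = us @ x # vs"
    using assms(1) set_program_order by (metis split_list)
  obtain X where X: "X \<in> execs" "ops X = {A}" "occurs_in_order X (po A)"
    using asynchrony[OF _ interleaving_program_order] by auto
  have less: "instant X x < instant X y"
    using before X by simp
  have "y \<notin> set us"
    using X(3) less by (auto simp: po occurs_in_order_def sorted_wrt_append)
  moreover have "y \<noteq> x"
    using less by auto
  moreover have "y \<in> set us \<union> {x} \<union> set vs"
    using assms(2) set_program_order[of A] po by auto
  ultimately have "y \<in> set vs"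
    by blast
  with po show thesis
    by (rule that)
qed

text \<open>The program order of \<open>A\<close> lists \<open>x\<close> before \<open>y\<close>,
  and asynchrony lets another process run \<open>B\<close> in full between two steps of
  \<open>A\<close>. This supplies the counterexamples to soundness and completeness.\<close>

lemma obtain_execution_nested:
  assumes "proc A \<noteq> proc B"
    and "x \<in> events_of A" "y \<in> events_of A"
    and "\<And>X. \<lbrakk>X \<in> execs; A \<in> ops X\<rbrakk> \<Longrightarrow> instant X x < instant X y"
  obtains X where "X \<in> execs" "A \<in> ops X" "B \<in> ops X"
    "\<And>e. e \<in> events_of B \<Longrightarrow> instant X x < instant X e \<and> instant X e < instant X y"
proof -
  obtain us vs where po: "po A = us @ x # vs" and y: "y \<in> set vs"
    using split_program_order assms(2-4) by blast
  \<comment> \<open>All of \<open>B\<close> is inserted right after \<open>x\<close>. As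
    \<open>y\<close> lies in \<open>vs\<close>, it still comes after every event of
    \<open>B\<close>.\<close>
  define w where "w = us @ x # po B @ vs"
  have neq: "A \<noteq> B"
    using assms(1) by auto
  have "set (po A) \<inter> set (po B) = {}"
    using events_of_disjoint[OF neq] by (simp add: set_program_order)
  then have "distinct w"
    using distinct_program_order[of A] distinct_program_order[of B]
    by (auto simp: w_def po)
  moreover have "set w = (\<Union>C\<in>{A, B}. events_of C)"
    unfolding w_def by (auto simp: po simp flip: set_program_order)
  moreover have "subseq (po A) w"
    unfolding w_def po by (intro list_emb_append_mono) auto
  moreover have "subseq (po B) w"
    using sublist_imp_subseq[OF sublist_appendI[of "po B" "us @ [x]" vs]] by (simp add: w_def)
  ultimately have "interleaving po {A, B} w"
    by (simp add: interleaving_def)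
  moreover have "inj_on proc {A, B}"
    using assms(1) by (auto simp: inj_on_def)
  ultimately obtain X where X: "X \<in> execs" "ops X = {A, B}" "occurs_in_order X w"
    using asynchrony by blast
  show thesis
  proof (rule that[of X])
    fix e assume "e \<in> events_of B"
    then show "instant X x < instant X e \<and> instant X e < instant X y"
      using X(3) y
      by (auto simp: w_def occurs_in_order_def sorted_wrt_append set_program_order)
  qed (use X in auto)
qed

lemma internal_placement_complete:
  assumes "ideal_log execs" "internal_placement execs"
  shows "COP_complete execs"
  unfolding COP_complete_def real_time_before_def
proof (intro ballI impI)
  fix X A B
  assume X: "X \<in> execs" "A \<in> ops X" "B \<in> ops X" and "time X (A, Res) < time X (B, Inv)"
  moreover have "lp X (A, Res) < time X (A, Res)" "time X (B, Inv) < lp X (B, Inv)"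
    using assms(2) X by (auto simp: internal_placement_def)
  ultimately have "lp X (A, Res) < lp X (B, Inv)"
    by linarith
  then show "Precedes X A B"
    using assms(1) X by (simp add: Precedes_def ideal_log_def)
qed

lemma external_placement_sound:
  assumes "ideal_log execs" "external_placement execs"
  shows "COP_sound execs"
  unfolding COP_sound_def real_time_before_def
proof (intro ballI impI)
  fix X A B
  assume X: "X \<in> execs" "A \<in> ops X" "B \<in> ops X" and "Precedes X A B"
  then have "lp X (A, Res) < lp X (B, Inv)"
    using assms(1) by (simp add: Precedes_def ideal_log_def)
  moreover have "time X (A, Res) < lp X (A, Res)" "lp X (B, Inv) < time X (B, Inv)"
    using assms(2) X by (auto simp: external_placement_def)
  ultimately show "time X (A, Res) < time X (B, Inv)"
    by linarith
qed

text \<open>Internal placement leaves a gap between \<open>lp X (A, Res)\<close> and the true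
  response of \<open>A\<close>. With \<open>B\<close> inside it, the log puts \<open>A\<close>
  before \<open>B\<close> although \<open>B\<close> is invoked before \<open>A\<close>
  responds.\<close>

lemma internal_placement_not_sound:
  assumes "ideal_log execs" "internal_placement execs"
  shows "\<not> COP_sound execs"
proof -
  obtain A B where AB: "proc A \<noteq> proc B"
    by (rule obtain_operations_on_distinct_processes)
  obtain X where X: "X \<in> execs" "A \<in> ops X" "B \<in> ops X"
    and nested: "\<And>e. e \<in> events_of B \<Longrightarrow> instant X (Interface (A, Res)) < instant X e
      \<and> instant X e < instant X (True_Boundary (A, Res))"
    by (rule obtain_execution_nested[OF AB, of "Interface (A, Res)" "True_Boundary (A, Res)"])
      (use assms(2) in \<open>auto simp: events_of_def internal_placement_def\<close>)
  have "lp X (A, Res) < lp X (B, Inv)" "time X (B, Inv) < time X (A, Res)"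
    using nested[of "Interface (B, Inv)"] nested[of "True_Boundary (B, Inv)"]
    by (auto simp: events_of_def)
  then have "Precedes X A B" "\<not> real_time_before X A B"
    using assms(1) X by (auto simp: Precedes_def real_time_before_def ideal_log_def)
  with X show ?thesis
    by (auto simp: COP_sound_def)
qed

text \<open>Here the gap is reversed: the true response of \<open>A\<close> comes first. With
  \<open>B\<close> inside it, \<open>A\<close> precedes \<open>B\<close> in real time, but the
  interface event for the response of \<open>A\<close> takes effect too late for the log to show
  this.\<close>

lemma external_placement_not_complete:
  assumes "ideal_log execs" "external_placement execs"
  shows "\<not> COP_complete execs"
proof -
  obtain A B where AB: "proc A \<noteq> proc B"
    by (rule obtain_operations_on_distinct_processes)
  obtain X where X: "X \<in> execs" "A \<in> ops X" "B \<in> ops X"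
    and nested: "\<And>e. e \<in> events_of B \<Longrightarrow> instant X (True_Boundary (A, Res)) < instant X e
      \<and> instant X e < instant X (Interface (A, Res))"
    by (rule obtain_execution_nested[OF AB, of "True_Boundary (A, Res)" "Interface (A, Res)"])
      (use assms(2) in \<open>auto simp: events_of_def external_placement_def\<close>)
  have "time X (A, Res) < time X (B, Inv)" "lp X (B, Inv) < lp X (A, Res)"
    using nested[of "Interface (B, Inv)"] nested[of "True_Boundary (B, Inv)"]
    by (auto simp: events_of_def)
  then have "real_time_before X A B" "\<not> Precedes X A B"
    using assms(1) X by (auto simp: Precedes_def real_time_before_def ideal_log_def)
  with X show ?thesis
    by (auto simp: COP_complete_def)
qed

end

theorem lemma11:
  fixes N :: nat
    and proc :: "'op \<Rightarrow> nat"
    and po :: "'op \<Rightarrow> 'op event list"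
    and execs :: "'op execution set"
  assumes "monitored_system N proc po execs"
    and "ideal_log execs"
  shows "(internal_placement execs \<longrightarrow> COP_complete execs \<and> \<not> COP_sound execs) \<and>
         (external_placement execs \<longrightarrow> COP_sound execs \<and> \<not> COP_complete execs)"
proof -
  interpret monitored_system N proc po execs
    by (rule assms(1))
  show ?thesis
    using assms(2) internal_placement_complete internal_placement_not_sound
      external_placement_sound external_placement_not_complete by blast
qed

end
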